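(* Let $X$ be a symmetric real random variable, not almost surely zero, with finite moments of all orders, and let $r_k=\frac{k!\,\mathbb{E}[X^{2k}]}{(2k)!}$ for $k\geq 0$. (1) If $(r_k)_{k\ge 0}$ is log-concave, then $X$ has the Schur-concave property for every even integer $p\geq 2$. (2) If $(r_k)_{k\ge 0}$ is log-convex, then $X$ has the Schur-convex property for every even integer $p\geq 2$.
   Context: A random variable $X$ is symmetric if $X$ and $-X$ have the same distribution. A sequence of positive numbers $(r_k)_{k\geq 0}$ is log-concave if $r_k^2\geq r_{k-1}r_{k+1}$ for all $k\geq 1$, and log-convex if $r_k^2\leq r_{k-1}r_{k+1}$ for all $k\geq 1$. For $x,y\in\mathbb{R}^n$ with decreasing rearrangements $\widetilde{x},\widetilde{y}$, write $x\prec y$ ($x$ is majorized by $y$) if $\sum_{j=1}^k\widetilde{x}_j\leq\sum_{j=1}^k\widetilde{y}_j$ for $k=1,\ldots,n$, with equality when $k=n$. Let $p\geq 1$, $\|\cdot\|_p=(\mathbb{E}|\cdot|^p)^{1/p}$, and let $X_1,X_2,\ldots$ be iid copies of $X$. $X$ has the Schur-concave property for $p$ if for all $n\geq 1$ and all $a,b\in\mathbb{R}^n$, $$(a_1^2,\ldots,a_n^2)\prec(b_1^2,\ldots,b_n^2)\Longrightarrow \Big\|\sum_{i=1}^n a_iX_i\Big\|_p\geq\Big\|\sum_{i=1}^n b_iX_i\Big\|_p.$$ $X$ has the Schur-convex property for $p$ if the same implication holds with $\geq$ replaced by $\leq$ in the conclusion. *)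

theory Defs
  imports "HOL-Probability.Probability"
begin

definition symmetric_rv :: "'a measure \<Rightarrow> ('a \<Rightarrow> real) \<Rightarrow> bool" where
  "symmetric_rv M X \<longleftrightarrow> distr M borel X = distr M borel (\<lambda>\<omega>. - X \<omega>)"

text \<open>Log-concavity and log-convexity are meant for sequences of positive numbers. Positivity is
  left to the place of use: for a random variable that is not almost surely zero and has finite
  moments, \<open>moment_ratio\<close> below is automatically positive.\<close>

definition log_concave_seq :: "(nat \<Rightarrow> real) \<Rightarrow> bool" where
  "log_concave_seq r \<longleftrightarrow> (\<forall>k\<ge>1. (r k)\<^sup>2 \<ge> r (k - 1) * r (k + 1))"

definition log_convex_seq :: "(nat \<Rightarrow> real) \<Rightarrow> bool" where
  "log_convex_seq r \<longleftrightarrow> (\<forall>k\<ge>1. (r k)\<^sup>2 \<le> r (k - 1) * r (k + 1))"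

definition moment_ratio :: "'a measure \<Rightarrow> ('a \<Rightarrow> real) \<Rightarrow> nat \<Rightarrow> real" where
  "moment_ratio M X k = fact k * (\<integral>\<omega>. X \<omega> ^ (2 * k) \<partial>M) / fact (2 * k)"

text \<open>A vector in \<open>n\<close>-dimensional space is a function \<open>nat \<Rightarrow> real\<close> of which only the entries with
  index \<open>< n\<close> matter.\<close>

definition decreasing_rearrangement :: "nat \<Rightarrow> (nat \<Rightarrow> real) \<Rightarrow> real list" where
  "decreasing_rearrangement n x = rev (sort (map x [0..<n]))"

definition majorized_by :: "nat \<Rightarrow> (nat \<Rightarrow> real) \<Rightarrow> (nat \<Rightarrow> real) \<Rightarrow> bool" where
  "majorized_by n x y \<longleftrightarrow>
     (\<forall>k\<in>{1..n}. (\<Sum>j<k. decreasing_rearrangement n x ! j)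
                \<le> (\<Sum>j<k. decreasing_rearrangement n y ! j)) \<and>
     (\<Sum>j<n. decreasing_rearrangement n x ! j) = (\<Sum>j<n. decreasing_rearrangement n y ! j)"

text \<open>Since the Bochner integral of a non-integrable function is \<open>0\<close>, this is the \<open>p\<close>-norm only for
  random variables with a finite absolute moment of order \<open>p\<close>.\<close>

definition Lp_norm :: "'a measure \<Rightarrow> real \<Rightarrow> ('a \<Rightarrow> real) \<Rightarrow> real" where
  "Lp_norm M p Y = (\<integral>\<omega>. \<bar>Y \<omega>\<bar> powr p \<partial>M) powr (1 / p)"

text \<open>The copies may live on a probability space \<open>N\<close> other than the one carrying \<open>X\<close>.\<close>

definition iid_copies ::
  "'a measure \<Rightarrow> ('a \<Rightarrow> real) \<Rightarrow> 'b measure \<Rightarrow> (nat \<Rightarrow> 'b \<Rightarrow> real) \<Rightarrow> bool" where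
  "iid_copies M X N Xs \<longleftrightarrow>
     prob_space N \<and> prob_space.indep_vars N (\<lambda>_. borel) Xs UNIV \<and>
     (\<forall>i. distr N borel (Xs i) = distr M borel X)"

text \<open>The Schur properties of a random variable, phrased for a sequence \<open>Xs\<close> of its iid copies on
  \<open>N\<close>; they depend only on the common law of the copies.\<close>

definition schur_concave_property :: "'b measure \<Rightarrow> (nat \<Rightarrow> 'b \<Rightarrow> real) \<Rightarrow> real \<Rightarrow> bool" where
  "schur_concave_property N Xs p \<longleftrightarrow>
     (\<forall>n\<ge>1. \<forall>a b :: nat \<Rightarrow> real.
        majorized_by n (\<lambda>i. (a i)\<^sup>2) (\<lambda>i. (b i)\<^sup>2) \<longrightarrow>
        Lp_norm N p (\<lambda>\<omega>. \<Sum>i<n. a i * Xs i \<omega>) \<ge> Lp_norm N p (\<lambda>\<omega>. \<Sum>i<n. b i * Xs i \<omega>))"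

definition schur_convex_property :: "'b measure \<Rightarrow> (nat \<Rightarrow> 'b \<Rightarrow> real) \<Rightarrow> real \<Rightarrow> bool" where
  "schur_convex_property N Xs p \<longleftrightarrow>
     (\<forall>n\<ge>1. \<forall>a b :: nat \<Rightarrow> real.
        majorized_by n (\<lambda>i. (a i)\<^sup>2) (\<lambda>i. (b i)\<^sup>2) \<longrightarrow>
        Lp_norm N p (\<lambda>\<omega>. \<Sum>i<n. a i * Xs i \<omega>) \<le> Lp_norm N p (\<lambda>\<omega>. \<Sum>i<n. b i * Xs i \<omega>))"

end

theory Submission
  imports Defs "HOL-Computational_Algebra.Formal_Laurent_Series"
begin

text \<open>
  The even moments of a weighted sum of independent symmetric variables are coefficients of a
  product of power series. Since the exponential generating function of the moments turns sums of
  independent variables into products, and all odd moments vanish, with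
  \<open>R(x, t) = (\<Sum>k. r\<^sub>k (x t)\<^sup>k / k!)\<close> the moment of order \<open>2m\<close> of \<open>\<Sum>i<n. a\<^sub>i X\<^sub>i\<close> is \<open>(2m)!\<close>
  times the coefficient of \<open>t\<^sup>m\<close> in the product of the \<open>R(a\<^sub>i\<^sup>2, t)\<close>
  (lemma \<open>even_moment_weighted_sum\<close>). The weights \<open>k!/(2k)!\<close> in the definition of the \<open>r\<^sub>k\<close>
  are exactly what makes this an exponential generating function again.

  It remains to see that this coefficient is a Schur-concave (or Schur-convex) function of the
  squares. For two variables \<open>p + s\<close> and \<open>p - s\<close> the derivative in \<open>s\<close> of the
  coefficient of \<open>t\<^bsup>M+1\<^esup>\<close> is a combination of the products
  \<open>(p + s)\<^bsup>j\<^esup> (p - s)\<^bsup>M-j\<^esup> / (j! (M - j)!)\<close> whose coefficients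
  \<open>r\<^sub>j\<^sub>+\<^sub>1 r\<^sub>M\<^sub>-\<^sub>j - r\<^sub>j r\<^sub>M\<^sub>+\<^sub>1\<^sub>-\<^sub>j\<close> are antisymmetric under \<open>j \<mapsto> M - j\<close>; pairing
  \<open>j\<close> with \<open>M - j\<close> shows that it has a constant sign, given by log-concavity or log-convexity
  (lemma \<open>egf_pair_spread_mono\<close>). The remaining factors of the product have nonnegative coefficients,
  so the two-variable inequality survives multiplication by them (lemma \<open>egf_prod_transfer\<close>).
  Finally, a vector \<open>y\<close> that majorizes \<open>x\<close> can be moved to \<open>x\<close> by finitely many transfers, each
  bringing two entries closer together while keeping their sum
  (lemma \<open>egf_prod_majorization\<close>).

  Both halves of the theorem run through the same argument: a sign \<open>\<epsilon>\<close>, equal to \<open>1\<close> in the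
  log-concave case and to \<open>-1\<close> in the log-convex case, multiplies every inequality.
\<close>

section \<open>Two-variable monotonicity\<close>

text \<open>For the moments of a variable, \<open>c = 1\<close>; for the ratios \<open>r\<^sub>k\<close>, \<open>c\<close> is a squared weight, so that
  majorization acts on this argument.\<close>
definition egf :: "(nat \<Rightarrow> real) \<Rightarrow> real \<Rightarrow> real fps" where
  "egf r c = Abs_fps (\<lambda>k. r k * c ^ k / fact k)"

lemma egf_nth [simp]: "fps_nth (egf r c) k = r k * c ^ k / fact k"
  by (simp add: egf_def)

text \<open>Adding the sum to its reflection turns each summand into \<open>d j * (w j - w (M - j))\<close>, whose factors
  have opposite signs in the lower half, hence by antisymmetry in the upper half as well.\<close>
lemma antisymmetric_sum_nonpos:
  fixes d w :: "nat \<Rightarrow> real"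
  assumes anti: "\<And>j. j \<le> M \<Longrightarrow> d (M - j) = - d j"
    and d: "\<And>j. 2 * j \<le> M \<Longrightarrow> d j \<ge> 0"
    and w: "\<And>j. 2 * j \<le> M \<Longrightarrow> w j \<le> w (M - j)"
  shows "(\<Sum>j\<le>M. d j * w j) \<le> 0"
proof -
  have flip: "(\<Sum>j\<le>M. d j * w j) = (\<Sum>j\<le>M. d (M - j) * w (M - j))"
    by (rule sum.reindex_bij_witness[of _ "\<lambda>j. M - j" "\<lambda>j. M - j"]) auto
  have "2 * (\<Sum>j\<le>M. d j * w j) = (\<Sum>j\<le>M. d j * w j + d (M - j) * w (M - j))"
    unfolding sum.distrib flip[symmetric] by simp
  also have "\<dots> = (\<Sum>j\<le>M. d j * (w j - w (M - j)))"
    by (intro sum.cong refl) (simp add: anti algebra_simps)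
  also have "\<dots> \<le> 0"
  proof (rule sum_nonpos)
    fix j assume "j \<in> {..M}"
    then have j: "j \<le> M" by simp
    show "d j * (w j - w (M - j)) \<le> 0"
    proof (cases "2 * j \<le> M")
      case True
      then show ?thesis using d[OF True] w[OF True] by (simp add: mult_le_0_iff)
    next
      case False
      then have "2 * (M - j) \<le> M" by simp
      from d[OF this] w[OF this] show ?thesis
        using anti[OF j] j by (simp add: mult_le_0_iff)
    qed
  qed
  finally show ?thesis by simp
qed

lemma power_mult_power_le_swap:
  fixes u v :: real
  assumes "0 \<le> v" "v \<le> u" "2 * j \<le> M"
  shows "u ^ j * v ^ (M - j) \<le> u ^ (M - j) * v ^ j"
proof -
  define l where "l = M - 2 * j"
  have l: "M - j = j + l" using assms(3) by (simp add: l_def)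
  have "(u ^ j * v ^ j) * v ^ l \<le> (u ^ j * v ^ j) * u ^ l"
    using assms by (intro mult_left_mono power_mono) auto
  then show ?thesis by (simp add: l power_add mult_ac)
qed

text \<open>For positive \<open>r\<close> the hypothesis \<open>cross\<close> says that \<open>r (k + 1) / r k\<close> is monotone in \<open>k\<close>,
  decreasing for \<open>\<epsilon> = 1\<close> and increasing for \<open>\<epsilon> = -1\<close>, in a form free of division. Differentiating in the spread
  produces cross terms of precisely this shape.\<close>
lemma egf_pair_spread_mono:
  fixes r :: "nat \<Rightarrow> real" and \<epsilon> :: real
  assumes cross: "\<And>i j. i \<le> j \<Longrightarrow> 0 \<le> \<epsilon> * (r (Suc i) * r j - r i * r (Suc j))"
    and st: "0 \<le> s" "s \<le> t" "t \<le> p"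
  shows "\<epsilon> * fps_nth (egf r (p + t) * egf r (p - t)) m
       \<le> \<epsilon> * fps_nth (egf r (p + s) * egf r (p - s)) m"
proof (cases m)
  case 0
  then show ?thesis by simp
next
  case (Suc M)
  define c where "c j = r j / fact j" for j
  define \<phi> where "\<phi> s = \<epsilon> * (\<Sum>j\<le>Suc M. c j * c (Suc M - j) * ((p + s) ^ j * (p - s) ^ (Suc M - j)))" for s
  have \<phi>: "\<epsilon> * fps_nth (egf r (p + s) * egf r (p - s)) m = \<phi> s" for s
    unfolding \<phi>_def fps_mult_nth Suc atLeast0AtMost
    by (simp only: egf_nth c_def times_divide_times_eq times_divide_eq_left times_divide_eq_right mult_ac)
  have "\<phi> t \<le> \<phi> s"
  proof (rule DERIV_nonpos_imp_nonincreasing[OF st(2)])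
    fix z assume z: "s \<le> z" "z \<le> t"
    define u v where "u = p + z" and "v = p - z"
    have uv: "0 \<le> v" "v \<le> u" using z st by (auto simp: u_def v_def)
    \<comment> \<open>The derivative at \<open>z\<close> collapses to \<open>\<Sum>j\<le>M. d j * w j\<close>: differentiation lowers one exponent,
      and an index shift brings both halves of the product rule to the same monomials.\<close>
    define d where "d j = \<epsilon> * (r (Suc j) * r (M - j) - r j * r (Suc M - j))" for j
    define w where "w j = u ^ j * v ^ (M - j) / (fact j * fact (M - j))" for j
    let ?D = "\<epsilon> * (\<Sum>j\<le>Suc M. c j * c (Suc M - j) *
              (of_nat j * u ^ (j - 1) * v ^ (Suc M - j)
               - of_nat (Suc M - j) * u ^ j * v ^ (Suc M - j - 1)))"
    have "(\<phi> has_real_derivative ?D) (at z)"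
      unfolding \<phi>_def u_def v_def
      by (rule derivative_eq_intros refl sum.cong | simp add: algebra_simps)+
    moreover have "?D = (\<Sum>j\<le>M. d j * w j)"
    proof -
      \<comment> \<open>the factor produced by differentiating a power cancels against the factorial\<close>
      have c: "c (Suc j) * a * (real (Suc j) * b * e) = r (Suc j) / fact j * a * b * e" for j a b e
      proof -
        have "c (Suc j) * real (Suc j) = r (Suc j) / fact j"
          by (simp add: c_def)
        then show ?thesis by (metis mult.assoc mult.commute)
      qed
      have c': "a * c (Suc j) * (real (Suc j) * b * e) = a * (r (Suc j) / fact j) * b * e" for j a b e
        using c[of j a b e] by (simp only: mult_ac)
      have "(\<Sum>j\<le>Suc M. c j * c (Suc M - j) *
              (of_nat j * u ^ (j - 1) * v ^ (Suc M - j)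
               - of_nat (Suc M - j) * u ^ j * v ^ (Suc M - j - 1)))
          = (\<Sum>j\<le>Suc M. c j * c (Suc M - j) * (of_nat j * u ^ (j - 1) * v ^ (Suc M - j)))
          - (\<Sum>j\<le>Suc M. c j * c (Suc M - j) * (of_nat (Suc M - j) * u ^ j * v ^ (Suc M - j - 1)))"
        by (simp add: right_diff_distrib sum_subtractf)
      also have "(\<Sum>j\<le>Suc M. c j * c (Suc M - j) * (of_nat j * u ^ (j - 1) * v ^ (Suc M - j)))
          = (\<Sum>j\<le>M. r (Suc j) * r (M - j) * w j)"
        unfolding sum.atMost_Suc_shift c
        by (auto intro!: sum.cong simp: c_def w_def)
      also have "(\<Sum>j\<le>Suc M. c j * c (Suc M - j) * (of_nat (Suc M - j) * u ^ j * v ^ (Suc M - j - 1)))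
          = (\<Sum>j\<le>M. r j * r (Suc M - j) * w j)"
        unfolding sum.atMost_Suc
        by (auto intro!: sum.cong simp: c' c_def w_def Suc_diff_le simp del: of_nat_Suc)
      finally show ?thesis
        by (simp add: d_def sum_distrib_left sum_subtractf[symmetric] algebra_simps)
    qed
    moreover have "(\<Sum>j\<le>M. d j * w j) \<le> 0"
    proof (rule antisymmetric_sum_nonpos)
      show "d (M - j) = - d j" if "j \<le> M" for j
        using that by (simp add: d_def Suc_diff_le algebra_simps)
      show "d j \<ge> 0" if "2 * j \<le> M" for j
        using cross[of j "M - j"] that by (simp add: d_def Suc_diff_le)
      show "w j \<le> w (M - j)" if "2 * j \<le> M" for j
        using power_mult_power_le_swap[OF uv that] that
        by (simp add: w_def mult.commute divide_right_mono)
    qed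
    ultimately show "\<exists>y. (\<phi> has_real_derivative y) (at z) \<and> y \<le> 0" by metis
  qed
  then show ?thesis by (simp add: \<phi>)
qed

lemma fps_nth_prod_nonneg:
  fixes f :: "'i \<Rightarrow> real fps"
  assumes "\<And>i k. i \<in> I \<Longrightarrow> 0 \<le> fps_nth (f i) k"
  shows "0 \<le> fps_nth (\<Prod>i\<in>I. f i) m"
  using assms
  by (induction I arbitrary: m rule: infinite_finite_induct)
     (auto simp: fps_mult_nth intro!: sum_nonneg mult_nonneg_nonneg)

text \<open>A transfer keeps the sum of the two chosen entries and shrinks their difference, so the
  product of their two factors changes monotonically coefficient by coefficient; convolving
  with the nonnegative coefficients of
  the other factors keeps the direction.\<close>
lemma egf_prod_transfer:
  fixes r y :: "nat \<Rightarrow> real" and \<epsilon> :: real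
  assumes cross: "\<And>i j. i \<le> j \<Longrightarrow> 0 \<le> \<epsilon> * (r (Suc i) * r j - r i * r (Suc j))"
    and r: "\<And>k. 0 \<le> r k"
    and I: "finite I" "j \<in> I" "k \<in> I" "j \<noteq> k"
    and y: "\<And>i. i \<in> I \<Longrightarrow> 0 \<le> y i"
    and \<delta>: "0 \<le> \<delta>" "y k + \<delta> \<le> y j - \<delta>"
  shows "\<epsilon> * fps_nth (\<Prod>i\<in>I. egf r (y i)) m
       \<le> \<epsilon> * fps_nth (\<Prod>i\<in>I. egf r ((y(j := y j - \<delta>, k := y k + \<delta>)) i)) m"
proof -
  define y' where "y' = y(j := y j - \<delta>, k := y k + \<delta>)"
  define J where "J = I - {j, k}"
  have split: "(\<Prod>i\<in>I. egf r (z i)) = egf r (z j) * egf r (z k) * (\<Prod>i\<in>J. egf r (z i))" for z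
  proof -
    have "I = insert j (insert k J)" "j \<notin> insert k J" "k \<notin> J" "finite J"
      using I by (auto simp: J_def)
    then show ?thesis by (simp add: mult.assoc)
  qed
  have rest: "(\<Prod>i\<in>J. egf r (y' i)) = (\<Prod>i\<in>J. egf r (y i))"
    by (rule prod.cong) (auto simp: J_def y'_def)
  define p s t where "p = (y j + y k) / 2" and "s = (y j - y k) / 2 - \<delta>" and "t = (y j - y k) / 2"
  have st: "0 \<le> s" "s \<le> t" "t \<le> p"
    using \<delta> y[OF I(3)] by (auto simp: p_def s_def t_def field_simps)
  have eqs: "p + t = y j" "p - t = y k" "p + s = y' j" "p - s = y' k"
    using I(4) by (auto simp: p_def s_def t_def y'_def field_simps)
  have pair: "\<epsilon> * fps_nth (egf r (y j) * egf r (y k)) l \<le> \<epsilon> * fps_nth (egf r (y' j) * egf r (y' k)) l" for l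
    using egf_pair_spread_mono[where r = r and \<epsilon> = \<epsilon>, OF cross st, of l] unfolding eqs .
  have "\<epsilon> * fps_nth (\<Prod>i\<in>I. egf r (y i)) m
      = (\<Sum>l=0..m. \<epsilon> * fps_nth (egf r (y j) * egf r (y k)) l * fps_nth (\<Prod>i\<in>J. egf r (y i)) (m - l))"
    unfolding split fps_mult_nth[of "egf r (y j) * egf r (y k)"] by (simp add: sum_distrib_left mult.assoc)
  also have "\<dots> \<le> (\<Sum>l=0..m. \<epsilon> * fps_nth (egf r (y' j) * egf r (y' k)) l * fps_nth (\<Prod>i\<in>J. egf r (y i)) (m - l))"
    by (intro sum_mono mult_right_mono pair fps_nth_prod_nonneg)
       (auto simp: J_def r y)
  also have "\<dots> = \<epsilon> * fps_nth (\<Prod>i\<in>I. egf r (y' i)) m"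
    unfolding split rest fps_mult_nth[of "egf r (y' j) * egf r (y' k)"] by (simp add: sum_distrib_left mult.assoc)
  finally show ?thesis unfolding y'_def .
qed

section \<open>From transfers to majorization\<close>

text \<open>Here \<open>k\<close> is the first index at which \<open>x\<close> exceeds \<open>y\<close>. It exists because the totals agree, and
  an earlier strict deficit exists because the partial sums of \<open>x\<close> do not exceed those of \<open>y\<close>.\<close>
lemma first_exceeding_index:
  fixes x y :: "nat \<Rightarrow> real"
  assumes le: "\<And>l. l \<le> n \<Longrightarrow> (\<Sum>i<l. x i) \<le> (\<Sum>i<l. y i)"
    and eq: "(\<Sum>i<n. x i) = (\<Sum>i<n. y i)"
    and ne: "\<exists>i<n. x i \<noteq> y i"
  obtains j k where "j < k" "k < n" "x j < y j" "y k < x k" "\<And>i. i < k \<Longrightarrow> x i \<le> y i"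
proof -
  have "\<exists>k<n. y k < x k"
  proof (rule ccontr)
    assume "\<not> ?thesis"
    then have a: "x i \<le> y i" if "i \<in> {..<n}" for i
      using that by (meson lessThan_iff not_less)
    obtain i where i: "i \<in> {..<n}" "x i < y i" using ne a by force
    have "(\<Sum>i<n. x i) < (\<Sum>i<n. y i)"
      by (rule sum_strict_mono_ex1) (use a i in auto)
    then show False using eq by simp
  qed
  then obtain k where k: "k < n" "y k < x k" "\<And>i. i < k \<Longrightarrow> \<not> (i < n \<and> y i < x i)"
    using exists_least_iff[of "\<lambda>k. k < n \<and> y k < x k"] by blast
  then have below: "x i \<le> y i" if "i < k" for i
    using that by force
  have "\<exists>j<k. x j < y j"
  proof (rule ccontr)
    assume "\<not> ?thesis"
    then have "(\<Sum>i<k. y i) \<le> (\<Sum>i<k. x i)" by (intro sum_mono) (meson lessThan_iff not_less)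
    with k(2) le[of "Suc k"] k(1) show False by simp
  qed
  then show ?thesis using that k below by blast
qed

text \<open>Each transfer makes \<open>y\<close> agree with \<open>x\<close> at one more index at least. It
  may destroy the order of \<open>y\<close>, which
  is why the partial sums of \<open>y\<close> are taken in the given order: the invariant then survives without
  sorting again. The two altered entries stay on either side of \<open>x k \<le> x j\<close>, so they cannot
  overtake each other.\<close>
lemma egf_prod_majorization:
  fixes r x y :: "nat \<Rightarrow> real" and \<epsilon> :: real
  assumes cross: "\<And>i j. i \<le> j \<Longrightarrow> 0 \<le> \<epsilon> * (r (Suc i) * r j - r i * r (Suc j))"
    and r: "\<And>k. 0 \<le> r k"
    and x: "\<And>i j. i \<le> j \<Longrightarrow> j < n \<Longrightarrow> x j \<le> x i" "\<And>i. i < n \<Longrightarrow> 0 \<le> x i"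
    and y: "\<And>i. i < n \<Longrightarrow> 0 \<le> y i"
    and le: "\<And>l. l \<le> n \<Longrightarrow> (\<Sum>i<l. x i) \<le> (\<Sum>i<l. y i)"
    and eq: "(\<Sum>i<n. x i) = (\<Sum>i<n. y i)"
  shows "\<epsilon> * fps_nth (\<Prod>i<n. egf r (y i)) m \<le> \<epsilon> * fps_nth (\<Prod>i<n. egf r (x i)) m"
  using y le eq
proof (induction "card {i. i < n \<and> x i \<noteq> y i}" arbitrary: y rule: less_induct)
  case less
  show ?case
  proof (cases "\<exists>i<n. x i \<noteq> y i")
    case False
    then have "(\<Prod>i<n. egf r (y i)) = (\<Prod>i<n. egf r (x i))"
      by (intro prod.cong) auto
    then show ?thesis by simp
  next
    case True
    obtain j k where jk: "j < k" "k < n" "x j < y j" "y k < x k" and below: "\<And>i. i < k \<Longrightarrow> x i \<le> y i"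
      using first_exceeding_index[OF less.prems(2,3) True] by blast
    \<comment> \<open>the largest amount that can be moved from \<open>j\<close> to \<open>k\<close> without crossing \<open>x\<close> at either index\<close>
    define \<delta> where "\<delta> = min (y j - x j) (x k - y k)"
    have \<delta>: "0 \<le> \<delta>" "\<delta> \<le> y j - x j" "\<delta> \<le> x k - y k" using jk by (auto simp: \<delta>_def)
    define y' where "y' = y(j := y j - \<delta>, k := y k + \<delta>)"
    have xjk: "x k \<le> x j" using x(1) jk by simp
    have sums: "(\<Sum>i<l. y' i) = (\<Sum>i<l. y i) - (if j < l then \<delta> else 0) + (if k < l then \<delta> else 0)" for l
    proof -
      have "y' i = y i - (if i = j then \<delta> else 0) + (if i = k then \<delta> else 0)" for i
        using jk by (simp add: y'_def)
      then show ?thesis by (simp add: sum.distrib sum_subtractf)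
    qed
    have fewer: "card {i. i < n \<and> x i \<noteq> y' i} < card {i. i < n \<and> x i \<noteq> y i}"
    proof (rule psubset_card_mono)
      have sub: "{i. i < n \<and> x i \<noteq> y' i} \<subseteq> {i. i < n \<and> x i \<noteq> y i}"
        using jk by (auto simp: y'_def split: if_splits)
      have "x j = y' j \<or> x k = y' k"
        using jk by (auto simp: y'_def \<delta>_def min_def)
      then have "j \<in> {i. i < n \<and> x i \<noteq> y i} - {i. i < n \<and> x i \<noteq> y' i} \<or>
          k \<in> {i. i < n \<and> x i \<noteq> y i} - {i. i < n \<and> x i \<noteq> y' i}"
        using jk by auto
      with sub show "{i. i < n \<and> x i \<noteq> y' i} \<subset> {i. i < n \<and> x i \<noteq> y i}" by blast
    qed simp
    have "\<epsilon> * fps_nth (\<Prod>i<n. egf r (y i)) m \<le> \<epsilon> * fps_nth (\<Prod>i<n. egf r (y' i)) m"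
      unfolding y'_def using jk \<delta> xjk less.prems(1)
      by (intro egf_prod_transfer[where r = r and \<epsilon> = \<epsilon>, OF cross r]) auto
    also have "\<dots> \<le> \<epsilon> * fps_nth (\<Prod>i<n. egf r (x i)) m"
    proof (rule less.hyps[OF fewer])
      show "0 \<le> y' i" if "i < n" for i
        using that less.prems(1)[of i] less.prems(1)[of k] x(2)[of j] jk \<delta> by (auto simp: y'_def)
      show "(\<Sum>i<l. x i) \<le> (\<Sum>i<l. y' i)" if l: "l \<le> n" for l
      proof (cases "j < l \<and> \<not> k < l")
        case True
        \<comment> \<open>Only these partial sums of \<open>y\<close> drop. They have room to do so: no entry of \<open>x\<close> before
          \<open>k\<close> exceeds that of \<open>y\<close>, and entry \<open>j\<close> alone contributes a slack of at least \<open>\<delta>\<close>.\<close>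
        have "\<delta> \<le> (\<Sum>i<l. y i - x i)"
          using member_le_sum[of j "{..<l}" "\<lambda>i. y i - x i"] True below \<delta> by force
        then show ?thesis using True by (simp add: sums sum_subtractf)
      next
        case False
        then show ?thesis using less.prems(2)[OF l] jk by (auto simp: sums)
      qed
      show "(\<Sum>i<n. x i) = (\<Sum>i<n. y' i)" using less.prems(3) jk by (simp add: sums)
    qed
    finally show ?thesis .
  qed
qed

lemma prod_decreasing_rearrangement:
  fixes f :: "real \<Rightarrow> 'c::comm_monoid_mult"
  shows "(\<Prod>i<n. f (decreasing_rearrangement n x ! i)) = (\<Prod>i<n. f (x i))"
proof -
  let ?xs = "decreasing_rearrangement n x"
  have "(\<Prod>i<n. f (?xs ! i)) = prod_list (map f ?xs)"
    by (simp add: prod.list_conv_set_nth decreasing_rearrangement_def atLeast0LessThan)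
  also have "\<dots> = prod_mset (image_mset f (mset ?xs))"
    by (simp flip: prod_mset_prod_list)
  also have "\<dots> = prod_list (map f (map x [0..<n]))"
    by (simp add: decreasing_rearrangement_def multiset.map_comp flip: prod_mset_prod_list)
  also have "\<dots> = (\<Prod>i<n. f (x i))"
    by (simp add: prod.list_conv_set_nth atLeast0LessThan)
  finally show ?thesis .
qed

lemma egf_prod_schur:
  fixes r x y :: "nat \<Rightarrow> real" and \<epsilon> :: real
  assumes cross: "\<And>i j. i \<le> j \<Longrightarrow> 0 \<le> \<epsilon> * (r (Suc i) * r j - r i * r (Suc j))"
    and r: "\<And>k. 0 \<le> r k"
    and x: "\<And>i. i < n \<Longrightarrow> 0 \<le> x i" and y: "\<And>i. i < n \<Longrightarrow> 0 \<le> y i"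
    and maj: "majorized_by n x y"
  shows "\<epsilon> * fps_nth (\<Prod>i<n. egf r (y i)) m \<le> \<epsilon> * fps_nth (\<Prod>i<n. egf r (x i)) m"
proof -
  let ?x = "\<lambda>i. decreasing_rearrangement n x ! i"
  let ?y = "\<lambda>i. decreasing_rearrangement n y ! i"
  have len: "length (decreasing_rearrangement n z) = n" for z
    by (simp add: decreasing_rearrangement_def)
  have nonneg: "0 \<le> decreasing_rearrangement n z ! i" if "\<And>i. i < n \<Longrightarrow> 0 \<le> z i" "i < n" for z i
  proof -
    have "decreasing_rearrangement n z ! i \<in> set (decreasing_rearrangement n z)"
      using that(2) by (simp add: len)
    then show ?thesis using that(1) by (auto simp: decreasing_rearrangement_def)
  qed
  have anti: "?x j \<le> ?x i" if "i \<le> j" "j < n" for i j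
  proof -
    have "sorted (rev (decreasing_rearrangement n x))"
      by (simp add: decreasing_rearrangement_def)
    then show ?thesis using that by (intro sorted_rev_nth_mono) (auto simp: len)
  qed
  have le: "(\<Sum>i<l. ?x i) \<le> (\<Sum>i<l. ?y i)" if "l \<le> n" for l
    using maj that by (cases "l = 0") (auto simp: majorized_by_def)
  have "\<epsilon> * fps_nth (\<Prod>i<n. egf r (?y i)) m \<le> \<epsilon> * fps_nth (\<Prod>i<n. egf r (?x i)) m"
  proof (rule egf_prod_majorization[where r = r and \<epsilon> = \<epsilon>, OF cross r])
    show "(\<Sum>i<n. ?x i) = (\<Sum>i<n. ?y i)" using maj by (simp add: majorized_by_def)
  qed (auto intro: anti le nonneg x y)
  then show ?thesis by (simp only: prod_decreasing_rearrangement[where f = "egf r"])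
qed

section \<open>Moments of sums of independent variables\<close>

text \<open>After division by \<open>k!\<close> the binomial expansion of \<open>(X + Y)\<^sup>k\<close> is the Cauchy product.\<close>
lemma (in prob_space) egf_moments_add:
  fixes X Y :: "'a \<Rightarrow> real"
  assumes ind: "indep_var borel X borel Y"
    and X: "\<And>k. integrable M (\<lambda>\<omega>. X \<omega> ^ k)" and Y: "\<And>k. integrable M (\<lambda>\<omega>. Y \<omega> ^ k)"
  shows "integrable M (\<lambda>\<omega>. (X \<omega> + Y \<omega>) ^ k)"
    and "egf (\<lambda>k. expectation (\<lambda>\<omega>. (X \<omega> + Y \<omega>) ^ k)) 1
       = egf (\<lambda>k. expectation (\<lambda>\<omega>. X \<omega> ^ k)) 1 * egf (\<lambda>k. expectation (\<lambda>\<omega>. Y \<omega> ^ k)) 1"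
proof -
  have ind': "indep_var borel (\<lambda>\<omega>. X \<omega> ^ i) borel (\<lambda>\<omega>. Y \<omega> ^ j)" for i j
    using indep_var_compose[OF ind, of "\<lambda>x. x ^ i" borel "\<lambda>x. x ^ j" borel] by (simp add: comp_def)
  note int = indep_var_integrable[OF ind' X Y]
  have binom: "(X \<omega> + Y \<omega>) ^ k = (\<Sum>i\<le>k. of_nat (k choose i) * (X \<omega> ^ i * Y \<omega> ^ (k - i)))" for \<omega> k
    by (simp add: binomial_ring mult.assoc)
  show "integrable M (\<lambda>\<omega>. (X \<omega> + Y \<omega>) ^ k)" for k
    unfolding binom by (intro Bochner_Integration.integrable_sum integrable_mult_right int)
  show "egf (\<lambda>k. expectation (\<lambda>\<omega>. (X \<omega> + Y \<omega>) ^ k)) 1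
       = egf (\<lambda>k. expectation (\<lambda>\<omega>. X \<omega> ^ k)) 1 * egf (\<lambda>k. expectation (\<lambda>\<omega>. Y \<omega> ^ k)) 1"
  proof (rule fps_ext)
    fix k
    have "expectation (\<lambda>\<omega>. (X \<omega> + Y \<omega>) ^ k) =
        (\<Sum>i\<le>k. of_nat (k choose i) * (expectation (\<lambda>\<omega>. X \<omega> ^ i) * expectation (\<lambda>\<omega>. Y \<omega> ^ (k - i))))"
      unfolding binom
      by (subst Bochner_Integration.integral_sum)
         (auto intro!: sum.cong integrable_mult_right int simp: indep_var_lebesgue_integral[OF ind' X Y])
    then show "fps_nth (egf (\<lambda>k. expectation (\<lambda>\<omega>. (X \<omega> + Y \<omega>) ^ k)) 1) k
       = fps_nth (egf (\<lambda>k. expectation (\<lambda>\<omega>. X \<omega> ^ k)) 1 * egf (\<lambda>k. expectation (\<lambda>\<omega>. Y \<omega> ^ k)) 1) k"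
      by (auto simp: fps_mult_nth atLeast0AtMost sum_divide_distrib binomial_fact intro!: sum.cong)
  qed
qed

lemma (in prob_space) egf_moments_sum:
  fixes X :: "'i \<Rightarrow> 'a \<Rightarrow> real"
  assumes "finite I" "indep_vars (\<lambda>_. borel) X I"
    and "\<And>i k. i \<in> I \<Longrightarrow> integrable M (\<lambda>\<omega>. X i \<omega> ^ k)"
  shows "(\<forall>k. integrable M (\<lambda>\<omega>. (\<Sum>i\<in>I. X i \<omega>) ^ k)) \<and>
         egf (\<lambda>k. expectation (\<lambda>\<omega>. (\<Sum>i\<in>I. X i \<omega>) ^ k)) 1
       = (\<Prod>i\<in>I. egf (\<lambda>k. expectation (\<lambda>\<omega>. X i \<omega> ^ k)) 1)"
  using assms
proof (induction I rule: finite_induct)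
  case empty
  have "egf (\<lambda>k. expectation (\<lambda>\<omega>. 0 ^ k)) 1 = 1"
    by (rule fps_ext) (simp add: power_0_left prob_space)
  then show ?case by (simp add: power_0_left)
next
  case (insert i I)
  have ind: "indep_var borel (X i) borel (\<lambda>\<omega>. \<Sum>i\<in>I. X i \<omega>)"
    using insert by (intro indep_vars_sum) auto
  have IH: "\<And>k. integrable M (\<lambda>\<omega>. (\<Sum>i\<in>I. X i \<omega>) ^ k)"
      "egf (\<lambda>k. expectation (\<lambda>\<omega>. (\<Sum>i\<in>I. X i \<omega>) ^ k)) 1
       = (\<Prod>i\<in>I. egf (\<lambda>k. expectation (\<lambda>\<omega>. X i \<omega> ^ k)) 1)"
    using insert.IH[OF indep_vars_subset[OF insert.prems(1)]] insert.prems(2) by auto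
  show ?case
    using egf_moments_add[OF ind insert.prems(2) IH(1)] insert.hyps IH(2) by simp
qed

lemma fps_compose_prod:
  fixes f :: "'i \<Rightarrow> 'c::idom fps"
  assumes "fps_nth g 0 = 0"
  shows "(\<Prod>i\<in>I. f i) oo g = (\<Prod>i\<in>I. f i oo g)"
  by (induction I rule: infinite_finite_induct) (simp_all add: fps_compose_mult_distrib[OF assms])

section \<open>Moments and ratios of a symmetric variable\<close>
lemma symmetric_rv_odd_moment:
  assumes sym: "symmetric_rv M X" and X: "X \<in> borel_measurable M" and "odd k"
  shows "(\<integral>\<omega>. X \<omega> ^ k \<partial>M) = 0"
proof -
  have "(\<integral>\<omega>. X \<omega> ^ k \<partial>M) = (\<integral>x. x ^ k \<partial>distr M borel X)"
    using X by (subst integral_distr) auto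
  also have "\<dots> = (\<integral>x. x ^ k \<partial>distr M borel (\<lambda>\<omega>. - X \<omega>))"
    using sym by (simp add: symmetric_rv_def)
  also have "\<dots> = (\<integral>\<omega>. (- X \<omega>) ^ k \<partial>M)"
    using X by (subst integral_distr) auto
  also have "\<dots> = - (\<integral>\<omega>. X \<omega> ^ k \<partial>M)"
    using \<open>odd k\<close> by (simp add: power_minus_odd)
  finally show ?thesis by simp
qed

lemma moment_ratio_pos:
  assumes "X \<in> borel_measurable M" "\<not> (AE \<omega> in M. X \<omega> = 0)"
    and int: "integrable M (\<lambda>\<omega>. X \<omega> ^ (2 * k))"
  shows "0 < moment_ratio M X k"
proof -
  have "(\<integral>\<omega>. X \<omega> ^ (2 * k) \<partial>M) \<noteq> 0"
  proof
    assume "(\<integral>\<omega>. X \<omega> ^ (2 * k) \<partial>M) = 0"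
    then have "AE \<omega> in M. X \<omega> ^ (2 * k) = 0"
      using integral_nonneg_eq_0_iff_AE[OF int] by simp
    then have "AE \<omega> in M. X \<omega> = 0" by (rule AE_mp) auto
    with assms(2) show False by simp
  qed
  moreover have "0 \<le> (\<integral>\<omega>. X \<omega> ^ (2 * k) \<partial>M)" by (intro integral_nonneg_AE) simp
  ultimately have "0 < (\<integral>\<omega>. X \<omega> ^ (2 * k) \<partial>M)" by linarith
  then show ?thesis by (simp add: moment_ratio_def)
qed

text \<open>Log-concavity of a positive sequence means that consecutive ratios decrease; comparing the ratios
  at \<open>i\<close> and \<open>j\<close> gives the cross inequality needed for the two-variable argument.\<close>
lemma log_concave_seq_cross:
  assumes pos: "\<And>k. 0 < r k" and "log_concave_seq r" "i \<le> j"
  shows "r i * r (Suc j) \<le> r (Suc i) * r j"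
proof -
  have step: "r (Suc (Suc k)) / r (Suc k) \<le> r (Suc k) / r k" for k
    using assms(2) pos[of k] pos[of "Suc k"] unfolding log_concave_seq_def
    by (auto simp: field_simps power2_eq_square dest: spec[of _ "Suc k"])
  have "r (Suc j) / r j \<le> r (Suc i) / r i"
    using lift_Suc_antimono_le[of "\<lambda>k. r (Suc k) / r k", OF step \<open>i \<le> j\<close>] .
  then show ?thesis using pos[of i] pos[of j] by (simp add: field_simps)
qed

lemma log_convex_seq_cross:
  assumes pos: "\<And>k. 0 < r k" and "log_convex_seq r" "i \<le> j"
  shows "r (Suc i) * r j \<le> r i * r (Suc j)"
proof -
  have step: "r (Suc k) / r k \<le> r (Suc (Suc k)) / r (Suc k)" for k
    using assms(2) pos[of k] pos[of "Suc k"] unfolding log_convex_seq_def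
    by (auto simp: field_simps power2_eq_square dest: spec[of _ "Suc k"])
  have "r (Suc i) / r i \<le> r (Suc j) / r j"
    using lift_Suc_mono_le[of "\<lambda>k. r (Suc k) / r k", OF step \<open>i \<le> j\<close>] .
  then show ?thesis using pos[of i] pos[of j] by (simp add: field_simps)
qed

lemma iid_copies_moments:
  assumes iid: "iid_copies M X N Xs" and X: "X \<in> borel_measurable M"
  shows "integrable N (\<lambda>\<omega>. Xs i \<omega> ^ k) \<longleftrightarrow> integrable M (\<lambda>\<omega>. X \<omega> ^ k)"
    and "(\<integral>\<omega>. Xs i \<omega> ^ k \<partial>N) = (\<integral>\<omega>. X \<omega> ^ k \<partial>M)"
proof -
  interpret N: prob_space N using iid by (simp add: iid_copies_def)
  have Xi: "Xs i \<in> borel_measurable N" 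
    using iid by (auto simp: iid_copies_def N.indep_vars_def)
  have eq: "distr N borel (Xs i) = distr M borel X" using iid by (simp add: iid_copies_def)
  show "integrable N (\<lambda>\<omega>. Xs i \<omega> ^ k) \<longleftrightarrow> integrable M (\<lambda>\<omega>. X \<omega> ^ k)"
    using integrable_distr_eq[OF Xi, of "\<lambda>x::real. x ^ k"] integrable_distr_eq[OF X, of "\<lambda>x::real. x ^ k"] eq by simp
  show "(\<integral>\<omega>. Xs i \<omega> ^ k \<partial>N) = (\<integral>\<omega>. X \<omega> ^ k \<partial>M)"
    using integral_distr[OF Xi, of "\<lambda>x::real. x ^ k"] integral_distr[OF X, of "\<lambda>x::real. x ^ k"] eq by simp
qed

text \<open>For a single scaled copy, the vanishing odd moments and the definition of the ratios say that
  its moment generating series is \<open>egf (moment_ratio M X) ((a i)\<^sup>2)\<close> with the square of the formal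
  variable substituted. Substitution commutes with products, so the coefficient at \<open>2 * m\<close> of the
  series of the sum is the coefficient at \<open>m\<close> of the product before substitution.\<close>
lemma even_moment_weighted_sum:
  assumes X: "X \<in> borel_measurable M" and sym: "symmetric_rv M X"
    and int: "\<And>k. integrable M (\<lambda>\<omega>. X \<omega> ^ k)"
    and iid: "iid_copies M X N Xs"
  shows "(\<integral>\<omega>. (\<Sum>i<n. a i * Xs i \<omega>) ^ (2 * m) \<partial>N)
       = fact (2 * m) * fps_nth (\<Prod>i<n. egf (moment_ratio M X) ((a i)\<^sup>2)) m"
proof -
  interpret N: prob_space N using iid by (simp add: iid_copies_def)
  have "N.indep_vars (\<lambda>_. borel) Xs {..<n}"
    using iid by (auto simp: iid_copies_def intro: N.indep_vars_subset)
  then have ind: "N.indep_vars (\<lambda>_. borel) (\<lambda>i \<omega>. a i * Xs i \<omega>) {..<n}"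
    by (rule N.indep_vars_compose2) auto
  have intN: "integrable N (\<lambda>\<omega>. (a i * Xs i \<omega>) ^ k)" for i k
    by (simp add: power_mult_distrib iid_copies_moments[OF iid X] int)
  have factor: "egf (\<lambda>k. \<integral>\<omega>. (a i * Xs i \<omega>) ^ k \<partial>N) 1 = egf (moment_ratio M X) ((a i)\<^sup>2) oo fps_X\<^sup>2" for i
  proof (rule fps_ext)
    fix k
    have nth: "fps_nth (egf (\<lambda>k. \<integral>\<omega>. (a i * Xs i \<omega>) ^ k \<partial>N) 1) k = a i ^ k * (\<integral>\<omega>. X \<omega> ^ k \<partial>M) / fact k"
      by (simp add: power_mult_distrib iid_copies_moments[OF iid X])
    show "fps_nth (egf (\<lambda>k. \<integral>\<omega>. (a i * Xs i \<omega>) ^ k \<partial>N) 1) k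
        = fps_nth (egf (moment_ratio M X) ((a i)\<^sup>2) oo fps_X\<^sup>2) k"
    proof (cases "even k")
      case True
      then obtain l where "k = 2 * l" by blast
      then show ?thesis unfolding nth fps_nth_compose_X_power
        by (simp add: moment_ratio_def power_mult)
    next
      case False
      then show ?thesis unfolding nth fps_nth_compose_X_power
        by (simp add: symmetric_rv_odd_moment[OF sym X])
    qed
  qed
  have "egf (\<lambda>k. \<integral>\<omega>. (\<Sum>i<n. a i * Xs i \<omega>) ^ k \<partial>N) 1
      = (\<Prod>i<n. egf (moment_ratio M X) ((a i)\<^sup>2)) oo fps_X\<^sup>2"
    using N.egf_moments_sum[OF finite_lessThan ind intN] by (simp add: factor fps_compose_prod)
  from arg_cong[OF this, of "\<lambda>f. fps_nth f (2 * m)"] show ?thesis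
    by (simp add: fps_nth_compose_X_power field_simps)
qed

section \<open>The Schur properties\<close>
lemma Lp_norm_even:
  assumes "m \<ge> 1"
  shows "Lp_norm N (real (2 * m)) Y = (\<integral>\<omega>. Y \<omega> ^ (2 * m) \<partial>N) powr (1 / real (2 * m))"
proof -
  have "\<bar>Y \<omega>\<bar> powr real (2 * m) = Y \<omega> ^ (2 * m)" for \<omega>
    using assms by (subst powr_realpow') (auto simp: power_even_abs)
  then show ?thesis unfolding Lp_norm_def by presburger
qed

lemma Lp_norm_even_mono:
  assumes "even p" "p \<ge> 2"
    and "(\<integral>\<omega>. Y \<omega> ^ p \<partial>N) \<le> (\<integral>\<omega>. Z \<omega> ^ p \<partial>N)"
  shows "Lp_norm N (real p) Y \<le> Lp_norm N (real p) Z"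
proof -
  obtain m where m: "p = 2 * m" using \<open>even p\<close> by blast
  then have "m \<ge> 1" using assms(2) by simp
  have "0 \<le> (\<integral>\<omega>. Y \<omega> ^ p \<partial>N)" using \<open>even p\<close> by (intro integral_nonneg_AE) auto
  then show ?thesis using assms(3) unfolding m Lp_norm_even[OF \<open>m \<ge> 1\<close>]
    by (intro powr_mono2) auto
qed

theorem theorem2p5:
  fixes M :: "'a measure" and X :: "'a \<Rightarrow> real"
    and N :: "'b measure" and Xs :: "nat \<Rightarrow> 'b \<Rightarrow> real"
  assumes "prob_space M"
    and "X \<in> borel_measurable M"
    and "symmetric_rv M X"
    and "\<not> (AE \<omega> in M. X \<omega> = 0)"
    and "\<And>k :: nat. integrable M (\<lambda>\<omega>. X \<omega> ^ k)"
    and "iid_copies M X N Xs"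
  shows "(log_concave_seq (moment_ratio M X) \<longrightarrow>
            (\<forall>p :: nat. even p \<and> p \<ge> 2 \<longrightarrow> schur_concave_property N Xs (real p))) \<and>
         (log_convex_seq (moment_ratio M X) \<longrightarrow>
            (\<forall>p :: nat. even p \<and> p \<ge> 2 \<longrightarrow> schur_convex_property N Xs (real p)))"
proof -
  let ?r = "moment_ratio M X"
  let ?E = "\<lambda>n a p. \<integral>\<omega>. (\<Sum>i<n. a i * Xs i \<omega>) ^ p \<partial>N"
  have pos: "0 < ?r k" for k
    using moment_ratio_pos[OF assms(2,4,5)] .
  have schur: "\<epsilon> * ?E n b p \<le> \<epsilon> * ?E n a p"
    if "\<And>i j. i \<le> j \<Longrightarrow> 0 \<le> \<epsilon> * (?r (Suc i) * ?r j - ?r i * ?r (Suc j))"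
      and "majorized_by n (\<lambda>i. (a i)\<^sup>2) (\<lambda>i. (b i)\<^sup>2)" and "even p"
    for \<epsilon> n p and a b :: "nat \<Rightarrow> real"
  proof -
    obtain m where m: "p = 2 * m" using \<open>even p\<close> by blast
    have "\<epsilon> * fps_nth (\<Prod>i<n. egf ?r ((b i)\<^sup>2)) m \<le> \<epsilon> * fps_nth (\<Prod>i<n. egf ?r ((a i)\<^sup>2)) m"
      using that pos by (intro egf_prod_schur) (auto intro: less_imp_le)
    then have "fact p * (\<epsilon> * fps_nth (\<Prod>i<n. egf ?r ((b i)\<^sup>2)) m)
        \<le> fact p * (\<epsilon> * fps_nth (\<Prod>i<n. egf ?r ((a i)\<^sup>2)) m)"
      by (rule mult_left_mono) simp
    then show ?thesis
      unfolding m even_moment_weighted_sum[OF assms(2,3,5,6)] by (simp only: mult.left_commute)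
  qed
  show ?thesis
  proof (intro conjI impI allI)
    fix p :: nat assume conc: "log_concave_seq ?r" and p: "even p \<and> p \<ge> 2"
    have "?E n b p \<le> ?E n a p" if "majorized_by n (\<lambda>i. (a i)\<^sup>2) (\<lambda>i. (b i)\<^sup>2)" for n a b
      using schur[of 1 n a b p] that p log_concave_seq_cross[OF pos conc] by simp
    then show "schur_concave_property N Xs (real p)"
      using p by (auto simp: schur_concave_property_def intro: Lp_norm_even_mono)
  next
    fix p :: nat assume conv: "log_convex_seq ?r" and p: "even p \<and> p \<ge> 2"
    have "?E n a p \<le> ?E n b p" if "majorized_by n (\<lambda>i. (a i)\<^sup>2) (\<lambda>i. (b i)\<^sup>2)" for n a b
      using schur[of "-1" n a b p] that p log_convex_seq_cross[OF pos conv] by simp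
    then show "schur_convex_property N Xs (real p)"
      using p by (auto simp: schur_convex_property_def intro: Lp_norm_even_mono)
  qed
qed

end
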